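(* Let $\mathbb{F}$ be a field with $\mathrm{char}(\mathbb{F})\neq 2$ and let $n\geq 1$. Then all left alternative and all alternative central extensions of $\mu_0^n$ are trivial; that is, every non-split central extension of $\mu_0^n$ (by a nonzero vector space) in the variety of left alternative algebras, and every such extension in the variety of alternative algebras, is isomorphic to $\mu_0^{n+1}$.
   Context: Algebras are over $\mathbb{F}$ and not necessarily associative. $\mu_0^n$ is the $n$-dimensional (associative, commutative) null-filiform algebra with basis $e_1,\dots,e_n$ and product $e_ie_j=e_{i+j}$, where $e_m=0$ for $m>n$. An algebra is left alternative if $x(xy)=(xx)y$ for all $x,y$, right alternative if $(xy)y=x(yy)$ for all $x,y$, and alternative if it is both. $\mathrm{Ann}(A)=\{x\in A: xA+Ax=0\}$. A central extension of an algebra $A$ by a vector space $V$ in a variety is an algebra of that variety of the form $A_\theta=A\oplus V$ with product $[x+v,y+w]_\theta=xy+\theta(x,y)$ for some bilinear map $\theta:A\times A\to V$. A central extension $E$ is non-split if there is no nonzero subspace $I\subseteq\mathrm{Ann}(E)$ such that $E=E_0\oplus I$ for some ideal $E_0$ of $E$. The central extension $\mu_0^{n+1}$ of $\mu_0^n$ is called trivial. *)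

theory Defs
  imports Complex_Main "HOL-Library.Function_Algebras" "HOL-Library.Product_Plus"
begin

text \<open>
  An algebra lives on a subspace \<open>carr\<close> of an ambient vector space; addition is that of the
  ambient type. Nothing is assumed about \<open>prd\<close> outside the carrier.
\<close>

record ('k, 'a) nalgebra =
  carr :: "'a set"
  scal :: "'k \<Rightarrow> 'a \<Rightarrow> 'a"
  prd :: "'a \<Rightarrow> 'a \<Rightarrow> 'a"

definition bilinear_on ::
  "('k \<Rightarrow> 'a::ab_group_add \<Rightarrow> 'a) \<Rightarrow> 'a set \<Rightarrow> ('k \<Rightarrow> 'b::ab_group_add \<Rightarrow> 'b) \<Rightarrow> 'b set
    \<Rightarrow> ('a \<Rightarrow> 'a \<Rightarrow> 'b) \<Rightarrow> bool" where
  "bilinear_on sA A sB B f \<longleftrightarrow>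
     (\<forall>x\<in>A. \<forall>y\<in>A. f x y \<in> B) \<and>
     (\<forall>x\<in>A. \<forall>y\<in>A. \<forall>z\<in>A. f (x + y) z = f x z + f y z \<and> f z (x + y) = f z x + f z y) \<and>
     (\<forall>c. \<forall>x\<in>A. \<forall>y\<in>A. f (sA c x) y = sB c (f x y) \<and> f x (sA c y) = sB c (f x y))"

locale nonassoc_algebra = vector_space "scal A"
  for A :: "('k::field, 'a::ab_group_add) nalgebra" +
  assumes carr_subspace: "subspace (carr A)"
    and prd_bilinear: "bilinear_on (scal A) (carr A) (scal A) (carr A) (prd A)"

definition left_alternative :: "('k::field, 'a::ab_group_add) nalgebra \<Rightarrow> bool" where
  "left_alternative A \<longleftrightarrow> nonassoc_algebra A \<and>
     (\<forall>x\<in>carr A. \<forall>y\<in>carr A. prd A x (prd A x y) = prd A (prd A x x) y)"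

definition right_alternative :: "('k::field, 'a::ab_group_add) nalgebra \<Rightarrow> bool" where
  "right_alternative A \<longleftrightarrow> nonassoc_algebra A \<and>
     (\<forall>x\<in>carr A. \<forall>y\<in>carr A. prd A (prd A x y) y = prd A x (prd A y y))"

definition alternative :: "('k::field, 'a::ab_group_add) nalgebra \<Rightarrow> bool" where
  "alternative A \<longleftrightarrow> left_alternative A \<and> right_alternative A"

definition alg_isomorphic ::
  "('k::field, 'a::ab_group_add) nalgebra \<Rightarrow> ('k, 'b::ab_group_add) nalgebra \<Rightarrow> bool" where
  "alg_isomorphic A B \<longleftrightarrow> (\<exists>\<phi>. bij_betw \<phi> (carr A) (carr B) \<and>
     (\<forall>x\<in>carr A. \<forall>y\<in>carr A. \<phi> (x + y) = \<phi> x + \<phi> y) \<and>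
     (\<forall>c. \<forall>x\<in>carr A. \<phi> (scal A c x) = scal B c (\<phi> x)) \<and>
     (\<forall>x\<in>carr A. \<forall>y\<in>carr A. \<phi> (prd A x y) = prd B (\<phi> x) (\<phi> y)))"

definition annihilator :: "('k::field, 'a::ab_group_add) nalgebra \<Rightarrow> 'a set" where
  "annihilator A = {x \<in> carr A. \<forall>y\<in>carr A. prd A x y = 0 \<and> prd A y x = 0}"

definition alg_ideal :: "('k::field, 'a::ab_group_add) nalgebra \<Rightarrow> 'a set \<Rightarrow> bool" where
  "alg_ideal A J \<longleftrightarrow> module.subspace (scal A) J \<and> J \<subseteq> carr A \<and>
     (\<forall>x\<in>J. \<forall>y\<in>carr A. prd A x y \<in> J \<and> prd A y x \<in> J)"

definition non_split :: "('k::field, 'a::ab_group_add) nalgebra \<Rightarrow> bool" where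
  "non_split E \<longleftrightarrow> \<not> (\<exists>I E\<^sub>0. module.subspace (scal E) I \<and> I \<noteq> {0} \<and> I \<subseteq> annihilator E \<and>
     alg_ideal E E\<^sub>0 \<and> carr E = {x + y | x y. x \<in> E\<^sub>0 \<and> y \<in> I} \<and> E\<^sub>0 \<inter> I = {0})"

definition extension_by ::
  "('k::field, 'a::ab_group_add) nalgebra \<Rightarrow> ('k \<Rightarrow> 'v::ab_group_add \<Rightarrow> 'v) \<Rightarrow> 'v set
    \<Rightarrow> ('a \<Rightarrow> 'a \<Rightarrow> 'v) \<Rightarrow> ('k, 'a \<times> 'v) nalgebra" where
  "extension_by A sV V \<theta> =
     \<lparr>carr = carr A \<times> V,
      scal = (\<lambda>c (x, v). (scal A c x, sV c v)),
      prd = (\<lambda>(x, v) (y, w). (prd A x y, \<theta> x y))\<rparr>"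

text \<open>A variety is given by its membership predicate.\<close>

definition central_extension_in ::
  "(('k::field, 'a::ab_group_add \<times> 'v::ab_group_add) nalgebra \<Rightarrow> bool) \<Rightarrow> ('k, 'a) nalgebra
    \<Rightarrow> ('k \<Rightarrow> 'v \<Rightarrow> 'v) \<Rightarrow> 'v set \<Rightarrow> ('k, 'a \<times> 'v) nalgebra \<Rightarrow> bool" where
  "central_extension_in variety A sV V E \<longleftrightarrow>
     (\<exists>\<theta>. bilinear_on (scal A) (carr A) sV V \<theta> \<and> E = extension_by A sV V \<theta>) \<and> variety E"

text \<open>
  The null-filiform algebra: vectors are their coordinate functions, supported in \<open>{1..n}\<close>, and
  \<open>nf_basis n m\<close> is the basis vector \<open>e\<^sub>m\<close>, which is zero unless \<open>1 \<le> m \<le> n\<close>. The product is the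
  bilinear extension of \<open>e\<^sub>i e\<^sub>j = e\<^sub>i\<^sub>+\<^sub>j\<close>.
\<close>

definition nf_basis :: "nat \<Rightarrow> nat \<Rightarrow> nat \<Rightarrow> 'k::field" where
  "nf_basis n m = (\<lambda>k. if k = m \<and> 1 \<le> m \<and> m \<le> n then 1 else 0)"

definition null_filiform :: "nat \<Rightarrow> ('k::field, nat \<Rightarrow> 'k) nalgebra" where
  "null_filiform n =
     \<lparr>carr = {x. \<forall>k. k \<notin> {1..n} \<longrightarrow> x k = 0},
      scal = (\<lambda>c x k. c * x k),
      prd = (\<lambda>x y k. \<Sum>i\<in>{1..n}. \<Sum>j\<in>{1..n}. x i * y j * nf_basis n (i + j) k)\<rparr>"

lemma nonassoc_algebra_null_filiform:
  "nonassoc_algebra (null_filiform n :: ('k::field, nat \<Rightarrow> 'k) nalgebra)"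
proof -
  let ?A = "null_filiform n :: ('k, nat \<Rightarrow> 'k) nalgebra"
  interpret vector_space "scal ?A"
    by unfold_locales (auto simp: null_filiform_def fun_eq_iff algebra_simps)
  show ?thesis
  proof
    show "subspace (carr ?A)"
      by (rule subspaceI) (auto simp: null_filiform_def)
    show "bilinear_on (scal ?A) (carr ?A) (scal ?A) (carr ?A) (prd ?A)"
      by (auto simp: bilinear_on_def null_filiform_def nf_basis_def fun_eq_iff distrib_right
            distrib_left sum.distrib sum_distrib_left mult.assoc mult.left_commute
            intro!: sum.neutral)
  qed
qed

lemma nf_basis_in_carr: "nf_basis n i \<in> carr (null_filiform n)"
  by (auto simp: nf_basis_def null_filiform_def)

lemma null_filiform_expansion:
  assumes "x \<in> carr (null_filiform n)"
  shows "x = (\<Sum>i\<in>{1..n}. scal (null_filiform n) (x i) (nf_basis n i))"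
proof
  fix k
  have sum_apply: "sum f S k = (\<Sum>i\<in>S. f i k)" for f :: "nat \<Rightarrow> nat \<Rightarrow> 'a" and S
    by (induction S rule: infinite_finite_induct) auto
  have "(\<Sum>i\<in>{1..n}. scal (null_filiform n) (x i) (nf_basis n i)) k
      = (\<Sum>i\<in>{1..n}. if i = k then x i else 0)"
    unfolding sum_apply
    by (rule sum.cong) (auto simp: null_filiform_def nf_basis_def)
  also have "\<dots> = x k"
    using assms by (auto simp: null_filiform_def)
  finally show "x k = (\<Sum>i\<in>{1..n}. scal (null_filiform n) (x i) (nf_basis n i)) k" by simp
qed

lemma prd_nf_basis:
  assumes "i \<in> {1..n}" "j \<in> {1..n}"
  shows "prd (null_filiform n) (nf_basis n i) (nf_basis n j) = nf_basis n (i + j)"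
proof
  fix k
  have "prd (null_filiform n) (nf_basis n i) (nf_basis n j) k
     = (\<Sum>i'\<in>{1..n}. \<Sum>j'\<in>{1..n}. if j' = j then if i' = i then nf_basis n (i' + j') k else 0 else 0)"
    unfolding null_filiform_def nalgebra.simps
    by (intro sum.cong) (use assms in \<open>auto simp: nf_basis_def\<close>)
  also have "\<dots> = nf_basis n (i + j) k"
    using assms by simp
  finally show "prd (null_filiform n) (nf_basis n i) (nf_basis n j) k = nf_basis n (i + j) k" .
qed

end

theory Submission
  imports Defs
begin

text \<open>
  Let \<open>E\<close> be a left alternative central extension of \<open>\<mu> = null_filiform n\<close> given by the bilinear
  map \<open>\<theta>\<close>. Left alternativity of \<open>E\<close> says that \<open>\<theta> x (x y) = \<theta> (x x) y\<close>. Replacing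
  \<open>x\<close> by \<open>x + z\<close> and inserting \<open>x = e\<^sub>i\<close>, \<open>z = e\<^sub>1\<close>, \<open>y = e\<^sub>j\<close> gives
  \<open>\<theta> e\<^sub>i e\<^bsub>j+1\<^esub> + \<theta> e\<^sub>1 e\<^bsub>i+j\<^esub> = 2 \<theta> e\<^bsub>i+1\<^esub> e\<^sub>j\<close>. As 2 is invertible, induction on \<open>i\<close> shows that
  \<open>\<theta> e\<^sub>i e\<^sub>j\<close> depends only on \<open>i + j\<close>: it is \<open>c\<^bsub>i+j\<^esub>\<close> with \<open>c\<^sub>k = \<theta> e\<^sub>1 e\<^bsub>k-1\<^esub>\<close>, and so it vanishes
  when \<open>i + j > n + 1\<close> (\<open>left_alternative_cocycle_on_basis\<close>).

  Consequently the elements \<open>b\<^sub>k = (e\<^sub>k, c\<^sub>k)\<close> of \<open>E\<close> satisfy \<open>b\<^sub>i b\<^sub>j = b\<^bsub>i+j\<^esub>\<close> and vanish for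
  \<open>k > n + 1\<close>, so \<open>e\<^sub>k \<mapsto> b\<^sub>k\<close> defines a homomorphism \<open>\<psi>\<close> from \<open>null_filiform (n + 1)\<close> to \<open>E\<close>
  (\<open>nf_lift_prd\<close>). Its image is an ideal that contains every product of \<open>E\<close>, maps onto \<open>\<mu>\<close>, and
  meets \<open>V\<close> in the line spanned by \<open>c\<^bsub>n+1\<^esub>\<close>. If \<open>W\<close> is a complement of that line in \<open>V\<close>, then \<open>E\<close>
  is the direct sum of the image of \<open>\<psi>\<close> and of \<open>W\<close>, which lies in the annihilator. A non-split \<open>E\<close>
  forces \<open>W = 0\<close>; then \<open>\<psi>\<close> is onto, and since \<open>V\<close> is nonzero so is \<open>c\<^bsub>n+1\<^esub>\<close>, which makes \<open>\<psi>\<close>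
  injective. Alternative algebras are left alternative, so both claims follow.
\<close>

section \<open>Bilinear maps\<close>

lemma bilinear_on_flip:
  "bilinear_on sA A sB B f \<Longrightarrow> bilinear_on sA A sB B (\<lambda>x y. f y x)"
  by (auto simp: bilinear_on_def)

lemma bilinear_on_zero_left:
  assumes "bilinear_on sA A sB B f" "0 \<in> A" "y \<in> A"
  shows "f 0 y = 0"
proof -
  have "f (0 + 0) y = f 0 y + f 0 y"
    using assms unfolding bilinear_on_def by blast
  then show ?thesis by simp
qed

lemma bilinear_on_zero_right:
  assumes "bilinear_on sA A sB B f" "0 \<in> A" "y \<in> A"
  shows "f y 0 = 0"
  by (rule bilinear_on_zero_left[OF bilinear_on_flip[OF assms(1)] assms(2,3)])

lemma bilinear_on_sum_left:
  assumes "vector_space sA" and sub: "module.subspace sA A"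
    and bil: "bilinear_on sA A sB B f"
    and u: "\<And>i. i \<in> S \<Longrightarrow> u i \<in> A" and y: "y \<in> A"
  shows "f (\<Sum>i\<in>S. sA (a i) (u i)) y = (\<Sum>i\<in>S. sB (a i) (f (u i) y))"
proof -
  interpret vector_space sA by fact
  show ?thesis
    using u
  proof (induction S rule: infinite_finite_induct)
    case (insert i S)
    have "sA (a i) (u i) \<in> A" "(\<Sum>i\<in>S. sA (a i) (u i)) \<in> A"
      using insert.prems sub by (auto intro: subspace_scale subspace_sum)
    moreover have "f (sA (a i) (u i)) y = sB (a i) (f (u i) y)"
      using bil insert.prems y unfolding bilinear_on_def by blast
    ultimately show ?case
      using insert bil y by (simp add: bilinear_on_def)
  qed (use bilinear_on_zero_left[OF bil _ y] sub in \<open>auto intro: subspace_0\<close>)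
qed

text \<open>
  This reduces multiplicativity of a linear map on a null-filiform algebra to products of basis
  vectors.
\<close>

lemma bilinear_on_null_filiform_eqI:
  fixes f g :: "(nat \<Rightarrow> 'k::field) \<Rightarrow> (nat \<Rightarrow> 'k) \<Rightarrow> 'b::ab_group_add"
  defines "M m \<equiv> (null_filiform m :: ('k, nat \<Rightarrow> 'k) nalgebra)"
  assumes f: "bilinear_on (scal (M m)) (carr (M m)) sB B f"
    and g: "bilinear_on (scal (M m)) (carr (M m)) sB B g"
    and basis: "\<And>i j. i \<in> {1..m} \<Longrightarrow> j \<in> {1..m}
      \<Longrightarrow> f (nf_basis m i) (nf_basis m j) = g (nf_basis m i) (nf_basis m j)"
    and x: "x \<in> carr (M m)" and y: "y \<in> carr (M m)"
  shows "f x y = g x y"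
proof -
  interpret nonassoc_algebra "M m"
    unfolding M_def by (rule nonassoc_algebra_null_filiform)
  have e: "nf_basis m i \<in> carr (M m)" for i
    unfolding M_def by (rule nf_basis_in_carr)
  have expand: "h x y = (\<Sum>i\<in>{1..m}. sB (x i) (\<Sum>j\<in>{1..m}. sB (y j) (h (nf_basis m i) (nf_basis m j))))"
    if h: "bilinear_on (scal (M m)) (carr (M m)) sB B h" for h
  proof -
    note left = bilinear_on_sum_left[OF vector_space_axioms carr_subspace]
    have "h x y = (\<Sum>i\<in>{1..m}. sB (x i) (h (nf_basis m i) y))"
      using left[OF h e y, of x "\<lambda>i. i" "{1..m}"] null_filiform_expansion[of x m] x
      by (simp add: M_def)
    moreover have "h (nf_basis m i) y = (\<Sum>j\<in>{1..m}. sB (y j) (h (nf_basis m i) (nf_basis m j)))" for i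
      using left[OF bilinear_on_flip[OF h] e e, of i y "\<lambda>j. j" "{1..m}"]
        null_filiform_expansion[of y m] y
      by (simp add: M_def)
    ultimately show ?thesis by simp
  qed
  show ?thesis
    unfolding expand[OF f] expand[OF g] by (intro sum.cong refl arg_cong2[where f = sB] basis)
qed

section \<open>Homomorphisms out of the null-filiform algebra\<close>

definition nf_lift ::
  "('k::field, 'a::ab_group_add) nalgebra \<Rightarrow> nat \<Rightarrow> (nat \<Rightarrow> 'a) \<Rightarrow> (nat \<Rightarrow> 'k) \<Rightarrow> 'a" where
  "nf_lift E m b z = (\<Sum>k\<in>{1..m}. scal E (z k) (b k))"

context nonassoc_algebra
begin

lemma prd_closed: "x \<in> carr A \<Longrightarrow> y \<in> carr A \<Longrightarrow> prd A x y \<in> carr A"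
  using prd_bilinear by (simp add: bilinear_on_def)

lemma nf_lift_basis:
  assumes "k \<in> {1..m}"
  shows "nf_lift A m b (nf_basis m k) = b k"
proof -
  have "nf_lift A m b (nf_basis m k) = (\<Sum>i\<in>{1..m}. if i = k then b i else 0)"
    unfolding nf_lift_def by (rule sum.cong) (use assms in \<open>auto simp: nf_basis_def\<close>)
  then show ?thesis using assms by simp
qed

lemma nf_lift_add: "nf_lift A m b (x + y) = nf_lift A m b x + nf_lift A m b y"
  by (simp add: nf_lift_def scale_left_distrib sum.distrib)

lemma nf_lift_scale:
  "nf_lift A m b (scal (null_filiform m) c x) = scal A c (nf_lift A m b x)"
  by (simp add: nf_lift_def null_filiform_def scale_sum_right)

lemma nf_lift_in_carr:
  assumes "\<And>k. k \<ge> 1 \<Longrightarrow> b k \<in> carr A"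
  shows "nf_lift A m b x \<in> carr A"
  unfolding nf_lift_def using assms carr_subspace by (auto intro!: subspace_sum subspace_scale)

text \<open>
  The null-filiform algebra is the free nilpotent associative algebra of class \<open>m\<close> on one generator: a
  homomorphism out of it is the same thing as a sequence of powers \<open>b\<^sub>1, b\<^sub>2, \<dots>\<close> that stops after
  \<open>m\<close> terms. Both sides are bilinear, so only basis vectors have to be compared.
\<close>

lemma nf_lift_prd:
  assumes b: "\<And>k. k \<ge> 1 \<Longrightarrow> b k \<in> carr A"
    and mult: "\<And>i j. 1 \<le> i \<Longrightarrow> 1 \<le> j \<Longrightarrow> prd A (b i) (b j) = b (i + j)"
    and zero: "\<And>k. k > m \<Longrightarrow> b k = 0"
    and x: "x \<in> carr (null_filiform m)" and y: "y \<in> carr (null_filiform m)"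
  shows "nf_lift A m b (prd (null_filiform m) x y)
    = prd A (nf_lift A m b x) (nf_lift A m b y)"
proof (rule bilinear_on_null_filiform_eqI[OF _ _ _ x y])
  interpret M: nonassoc_algebra "null_filiform m" by (rule nonassoc_algebra_null_filiform)
  have carr: "nf_lift A m b z \<in> carr A" for z using b by (rule nf_lift_in_carr)
  show "bilinear_on (scal (null_filiform m)) (carr (null_filiform m)) (scal A) (carr A)
      (\<lambda>x y. nf_lift A m b (prd (null_filiform m) x y))"
    using M.prd_bilinear carr by (auto simp: bilinear_on_def nf_lift_add nf_lift_scale)
  show "bilinear_on (scal (null_filiform m)) (carr (null_filiform m)) (scal A) (carr A)
      (\<lambda>x y. prd A (nf_lift A m b x) (nf_lift A m b y))"
    using prd_bilinear carr by (auto simp: bilinear_on_def nf_lift_add nf_lift_scale)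
next
  fix i j assume ij: "i \<in> {1..m}" "j \<in> {1..m}"
  have "nf_lift A m b (nf_basis m (i + j)) = b (i + j)"
  proof (cases "i + j \<le> m")
    case False
    \<comment> \<open>Here \<open>e\<^bsub>i+j\<^esub>\<close> is zero in the source, which is where the vanishing of \<open>b\<close> beyond \<open>m\<close> enters.\<close>
    then show ?thesis using zero[of "i + j"] by (auto simp: nf_lift_def nf_basis_def)
  qed (use ij in \<open>auto intro: nf_lift_basis\<close>)
  then show "nf_lift A m b (prd (null_filiform m) (nf_basis m i) (nf_basis m j))
      = prd A (nf_lift A m b (nf_basis m i)) (nf_lift A m b (nf_basis m j))"
    using ij mult[of i j] by (simp add: prd_nf_basis nf_lift_basis)
qed

end

lemma alg_isomorphic_sym:
  assumes "nonassoc_algebra A" and "alg_isomorphic A B"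
  shows "alg_isomorphic B A"
proof -
  interpret nonassoc_algebra A by fact
  obtain \<phi> where bij: "bij_betw \<phi> (carr A) (carr B)"
    and add: "\<And>x y. x \<in> carr A \<Longrightarrow> y \<in> carr A \<Longrightarrow> \<phi> (x + y) = \<phi> x + \<phi> y"
    and scale: "\<And>c x. x \<in> carr A \<Longrightarrow> \<phi> (scal A c x) = scal B c (\<phi> x)"
    and prd: "\<And>x y. x \<in> carr A \<Longrightarrow> y \<in> carr A \<Longrightarrow> \<phi> (prd A x y) = prd B (\<phi> x) (\<phi> y)"
    using assms(2) unfolding alg_isomorphic_def by blast
  define \<psi> where "\<psi> = inv_into (carr A) \<phi>"
  have \<psi>: "\<psi> x \<in> carr A" "\<phi> (\<psi> x) = x" if "x \<in> carr B" for x
    using that bij unfolding \<psi>_def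
    by (auto simp: bij_betw_def inv_into_into f_inv_into_f)
  have inv: "\<psi> (\<phi> x) = x" if "x \<in> carr A" for x
    using that bij unfolding \<psi>_def by (simp add: bij_betw_inv_into_left)
  show ?thesis
    unfolding alg_isomorphic_def
  proof (intro exI[of _ \<psi>] conjI ballI allI)
    show "bij_betw \<psi> (carr B) (carr A)"
      unfolding \<psi>_def by (rule bij_betw_inv_into[OF bij])
    fix x y assume "x \<in> carr B" "y \<in> carr B"
    then show "\<psi> (x + y) = \<psi> x + \<psi> y" "\<psi> (prd B x y) = prd A (\<psi> x) (\<psi> y)"
      using add[of "\<psi> x" "\<psi> y"] prd[of "\<psi> x" "\<psi> y"] inv[of "\<psi> x + \<psi> y"]
        inv[of "prd A (\<psi> x) (\<psi> y)"] \<psi> carr_subspace prd_closed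
      by (auto simp: subspace_add)
  next
    fix c x assume "x \<in> carr B"
    then show "\<psi> (scal B c x) = scal A c (\<psi> x)"
      using scale[of "\<psi> x" c] inv[of "scal A c (\<psi> x)"] \<psi> carr_subspace
      by (auto simp: subspace_scale)
  qed
qed

section \<open>Left alternative cocycles\<close>

lemma (in vector_space) double_cancel:
  fixes v w :: 'b
  assumes "CHAR('a) \<noteq> 2" and "v + v = w + w"
  shows "v = w"
proof -
  have "(2 :: 'a) \<noteq> 0"
  proof
    assume "(2 :: 'a) = 0"
    then have "CHAR('a) dvd 2"
      using of_nat_eq_0_iff_char_dvd[where 'a = 'a, of 2] by simp
    moreover from this have "CHAR('a) \<le> 2" by (rule dvd_imp_le) simp
    ultimately have "CHAR('a) = 1 \<or> CHAR('a) = 2" by (auto simp: le_Suc_eq numeral_2_eq_2)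
    then show False using assms(1) CHAR_not_1[where 'a = 'a] by auto
  qed
  moreover have "scale 2 (v - w) = 0"
    using assms(2) scale_left_distrib[of 1 1 "v - w"] by (simp add: algebra_simps)
  ultimately show ?thesis by simp
qed

text \<open>
  Since \<open>nf_basis n i\<close> is zero for \<open>i > n\<close>, the multiplication rule holds for all positive indices.
  This lets the induction over basis vectors run without case distinctions at the top degree.
\<close>

lemma prd_nf_basis_ge_1:
  assumes "1 \<le> i" "1 \<le> j"
  shows "prd (null_filiform n) (nf_basis n i) (nf_basis n j) = nf_basis n (i + j)"
proof (cases "i \<le> n \<and> j \<le> n")
  case True
  then show ?thesis using assms by (intro prd_nf_basis) auto
next
  case False
  then show ?thesis by (auto simp: null_filiform_def nf_basis_def fun_eq_iff)
qed

text \<open>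
  The identity is quadratic in \<open>x\<close>; comparing its values at \<open>x + z\<close>, \<open>x\<close> and \<open>z\<close> isolates the
  part that is bilinear in \<open>x\<close> and \<open>z\<close>.
\<close>

lemma left_alternative_cocycle_linearized:
  assumes "nonassoc_algebra A" and \<theta>: "bilinear_on (scal A) (carr A) sV V \<theta>"
    and alt: "\<forall>x\<in>carr A. \<forall>y\<in>carr A. \<theta> x (prd A x y) = \<theta> (prd A x x) y"
    and x: "x \<in> carr A" and z: "z \<in> carr A" and y: "y \<in> carr A"
  shows "\<theta> x (prd A z y) + \<theta> z (prd A x y) = \<theta> (prd A x z) y + \<theta> (prd A z x) y"
proof -
  interpret nonassoc_algebra A by fact
  have sum: "x + z \<in> carr A" using x z carr_subspace by (simp add: subspace_add)
  have p: "prd A (u + u') w = prd A u w + prd A u' w" "prd A w (u + u') = prd A w u + prd A w u'"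
    if "u \<in> carr A" "u' \<in> carr A" "w \<in> carr A" for u u' w
    using that prd_bilinear by (auto simp: bilinear_on_def)
  have t: "\<theta> (u + u') w = \<theta> u w + \<theta> u' w" "\<theta> w (u + u') = \<theta> w u + \<theta> w u'"
    if "u \<in> carr A" "u' \<in> carr A" "w \<in> carr A" for u u' w
    using that \<theta> by (auto simp: bilinear_on_def)
  show ?thesis
    using alt[rule_format, OF sum y] alt[rule_format, OF x y] alt[rule_format, OF z y] x y z sum
    by (simp add: p t prd_closed subspace_add[OF carr_subspace] algebra_simps)
qed

text \<open>
  Write \<open>a\<^sub>i = \<theta> e\<^sub>i e\<^bsub>s-i\<^esub>\<close> for a fixed degree \<open>s\<close>. The linearized identity at \<open>e\<^sub>i\<close>, \<open>e\<^sub>1\<close>,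
  \<open>e\<^bsub>s-i-1\<^esub>\<close> reads \<open>a\<^sub>i + a\<^sub>1 = 2 a\<^bsub>i+1\<^esub>\<close>, so all \<open>a\<^sub>i\<close> equal \<open>a\<^sub>1\<close> outside characteristic 2. The
  degree \<open>s\<close> may exceed \<open>n + 1\<close>; then \<open>e\<^bsub>s-1\<^esub> = 0\<close>, and the values of \<open>\<theta>\<close> in that degree vanish.
\<close>

lemma left_alternative_cocycle_on_basis:
  fixes n :: nat and \<theta> :: "(nat \<Rightarrow> 'k::field) \<Rightarrow> (nat \<Rightarrow> 'k) \<Rightarrow> 'v::ab_group_add"
  defines "A \<equiv> (null_filiform n :: ('k, nat \<Rightarrow> 'k) nalgebra)"
  assumes char: "CHAR('k) \<noteq> 2" and "vector_space sV"
    and \<theta>: "bilinear_on (scal A) (carr A) sV V \<theta>"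
    and alt: "\<forall>x\<in>carr A. \<forall>y\<in>carr A. \<theta> x (prd A x y) = \<theta> (prd A x x) y"
    and "1 \<le> i" "1 \<le> j"
  shows "\<theta> (nf_basis n i) (nf_basis n j) = \<theta> (nf_basis n 1) (nf_basis n (i + j - 1))"
  using assms(6,7)
proof (induction i arbitrary: j rule: nat_induct_at_least)
  case base
  then show ?case by simp
next
  case (Suc i)
  interpret V: vector_space sV by fact
  let ?e = "nf_basis n :: nat \<Rightarrow> nat \<Rightarrow> 'k"
  have "\<theta> (?e i) (?e (1 + j)) + \<theta> (?e 1) (?e (i + j)) = \<theta> (?e (Suc i)) (?e j) + \<theta> (?e (Suc i)) (?e j)"
    using left_alternative_cocycle_linearized[OF _ \<theta> alt, of "?e i" "?e 1" "?e j"] Suc.hyps \<open>1 \<le> j\<close>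
    by (simp add: A_def nonassoc_algebra_null_filiform nf_basis_in_carr prd_nf_basis_ge_1)
  moreover have "\<theta> (?e i) (?e (1 + j)) = \<theta> (?e 1) (?e (i + j))"
    using Suc.IH[of "1 + j"] by simp
  ultimately show ?case
    using V.double_cancel[OF char, of "\<theta> (?e 1) (?e (i + j))" "\<theta> (?e (Suc i)) (?e j)"] by simp
qed

section \<open>Central extensions\<close>

text \<open>
  For \<open>c = 0\<close> the line degenerates and \<open>W = V\<close>; stating the two properties of a complement through
  multiples of \<open>c\<close> covers this case as well.
\<close>

lemma (in vector_space) line_complement_in_subspace:
  assumes V: "subspace V" and c: "c \<in> V"
  obtains W where "subspace W" "W \<subseteq> V" "\<And>l. scale l c \<in> W \<Longrightarrow> scale l c = 0"
    "\<And>v. v \<in> V \<Longrightarrow> \<exists>l. v - scale l c \<in> W"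
proof -
  have "independent ({c} - {0})" by (cases "c = 0") (auto simp: independent_empty)
  then obtain B where B: "{c} - {0} \<subseteq> B" "B \<subseteq> V" "independent B" "V \<subseteq> span B"
    using maximal_independent_subset_extend[of "{c} - {0}" V] c by blast
  show thesis
  proof
    show "subspace (span (B - {c}))" by simp
    show "span (B - {c}) \<subseteq> V" using B(2) V by (intro span_minimal) auto
    show "scale l c = 0" if "scale l c \<in> span (B - {c})" for l
    proof (rule ccontr)
      assume nz: "scale l c \<noteq> 0"
      then have "scale (inverse l) (scale l c) \<in> span (B - {c})"
        using that span_scale by blast
      then have "c \<in> span (B - {c})" using nz by simp
      moreover have "c \<in> B" using nz B(1) by auto
      ultimately show False using B(3) dependent_def by blast
    qed
    show "\<exists>l. v - scale l c \<in> span (B - {c})" if "v \<in> V" for v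
    proof (rule span_breakdown_eq[THEN iffD1])
      show "v \<in> span (insert c (B - {c}))"
        using that B(4) span_mono[of B "insert c (B - {c})"] by blast
    qed
  qed
qed

text \<open>
  The proof builds the isomorphism in the direction \<open>null_filiform (n + 1) \<rightarrow> E\<close>, because there it
  is given by the images of the basis vectors.
\<close>

lemma left_alternative_non_split_iso:
  fixes n :: nat
    and sV :: "'k::field \<Rightarrow> 'v::ab_group_add \<Rightarrow> 'v"
    and V :: "'v set"
  assumes char: "CHAR('k) \<noteq> 2"
    and "vector_space sV" and V: "module.subspace sV V" "V \<noteq> {0}"
    and ext: "central_extension_in left_alternative (null_filiform n) sV V E"
    and ns: "non_split E"
  shows "alg_isomorphic E (null_filiform (n + 1))"
proof -
  let ?A = "null_filiform n :: ('k, nat \<Rightarrow> 'k) nalgebra"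
  let ?M = "null_filiform (n + 1) :: ('k, nat \<Rightarrow> 'k) nalgebra"
  let ?e = "nf_basis n :: nat \<Rightarrow> nat \<Rightarrow> 'k"
  obtain \<theta> where \<theta>: "bilinear_on (scal ?A) (carr ?A) sV V \<theta>" and E: "E = extension_by ?A sV V \<theta>"
    and la: "left_alternative E"
    using ext unfolding central_extension_in_def by blast
  interpret V: vector_space sV by fact
  interpret A: nonassoc_algebra ?A by (rule nonassoc_algebra_null_filiform)
  interpret M: nonassoc_algebra ?M by (rule nonassoc_algebra_null_filiform)
  interpret E: nonassoc_algebra E using la by (simp add: left_alternative_def)
  have carrE: "carr E = carr ?A \<times> V"
    and scalE: "scal E a (x, v) = (scal ?A a x, sV a v)"
    and prdE: "prd E (x, v) (y, w) = (prd ?A x y, \<theta> x y)" for a x y v w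
    by (simp_all add: E extension_by_def)
  have V0: "0 \<in> V" using V(1) V.subspace_0 by blast
  have A0: "0 \<in> carr ?A" using A.carr_subspace A.subspace_0 by blast
  have e: "?e i \<in> carr ?A" for i by (rule nf_basis_in_carr)
  have e_zero: "?e i = 0" if "i > n \<or> i = 0" for i
    using that by (auto simp: nf_basis_def fun_eq_iff)
  have alt: "\<forall>x\<in>carr ?A. \<forall>y\<in>carr ?A. \<theta> x (prd ?A x y) = \<theta> (prd ?A x x) y"
  proof (intro ballI)
    fix x y assume that: "x \<in> carr ?A" "y \<in> carr ?A"
    have "prd E (x, 0) (prd E (x, 0) (y, 0)) = prd E (prd E (x, 0) (x, 0)) (y, 0)"
      using la that V0 by (auto simp: left_alternative_def carrE)
    then show "\<theta> x (prd ?A x y) = \<theta> (prd ?A x x) y" by (simp add: prdE)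
  qed

  \<comment> \<open>\<open>c 1 = \<theta> e\<^sub>1 0 = 0\<close>, so that \<open>b 1 = (e\<^sub>1, 0)\<close>, while \<open>b (n + 1) = (0, c (n + 1))\<close> lies in \<open>V\<close>.\<close>
  define c where "c k = \<theta> (?e 1) (?e (k - 1))" for k
  define b where "b k = (?e k, c k)" for k
  define \<psi> where "\<psi> = nf_lift E (n + 1) b"
  have c: "c k \<in> V" for k
    using \<theta> e by (simp add: c_def bilinear_on_def)
  have b: "b k \<in> carr E" for k
    by (simp only: b_def carrE) (simp add: c e)
  have b_mult: "prd E (b i) (b j) = b (i + j)" if "1 \<le> i" "1 \<le> j" for i j
    unfolding b_def c_def prdE prd_nf_basis_ge_1[OF that]
    using left_alternative_cocycle_on_basis[OF char V.vector_space_axioms \<theta> alt that] by (rule arg_cong)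
  have b_zero: "b k = 0" if "k > n + 1" for k
    using that bilinear_on_zero_right[OF \<theta> A0 e] by (simp add: b_def c_def e_zero zero_prod_def)
  have \<psi>_add: "\<psi> (x + y) = \<psi> x + \<psi> y"
    and \<psi>_scale: "\<psi> (scal ?M a x) = scal E a (\<psi> x)"
    and \<psi>_carr: "\<psi> x \<in> carr E" for x y a
    unfolding \<psi>_def by (intro E.nf_lift_add E.nf_lift_scale E.nf_lift_in_carr b)+
  have \<psi>_prd: "\<psi> (prd ?M x y) = prd E (\<psi> x) (\<psi> y)" if "x \<in> carr ?M" "y \<in> carr ?M" for x y
    unfolding \<psi>_def by (rule E.nf_lift_prd) (use b b_mult b_zero that in auto)
  have fst_\<psi>: "fst (\<psi> z) k = (if k \<in> {1..n} then z k else 0)" for z k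
  proof -
    have apply_sum: "(\<Sum>i\<in>S. f i) k = (\<Sum>i\<in>S. f i k)" for f :: "nat \<Rightarrow> nat \<Rightarrow> 'k" and S
      by (induction S rule: infinite_finite_induct) auto
    have "fst (\<psi> z) k = (\<Sum>i\<in>{1..n+1}. if i = k then (if k \<le> n then z k else 0) else 0)"
      unfolding \<psi>_def nf_lift_def fst_sum apply_sum
      by (rule sum.cong) (auto simp: b_def scalE null_filiform_def nf_basis_def)
    then show ?thesis by auto
  qed
  have snd_\<psi>: "snd (\<psi> z) = (\<Sum>k\<in>{1..n+1}. sV (z k) (c k))" for z
    unfolding \<psi>_def nf_lift_def snd_sum by (simp add: b_def scalE)

  have ker: "\<psi> z = (0, sV (z (n + 1)) (c (n + 1)))" if "fst (\<psi> z) = 0" for z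
  proof -
    have "z k = 0" if "k \<in> {1..n}" for k
      using fst_\<psi>[of z k] that \<open>fst (\<psi> z) = 0\<close> by simp
    then have "snd (\<psi> z) = sV (z (n + 1)) (c (n + 1))"
      by (simp add: snd_\<psi>)
    then show ?thesis using that by (simp add: prod_eq_iff)
  qed
  \<comment> \<open>Every vector of the quotient lifts, with the coordinate along \<open>e\<^bsub>n+1\<^esub>\<close> free to choose.\<close>
  have \<psi>_sec: "\<exists>z\<in>carr ?M. fst (\<psi> z) = x \<and> z (n + 1) = a" if "x \<in> carr ?A" for x a
  proof
    define z where "z = x(n + 1 := a)"
    show "z \<in> carr ?M" using that by (auto simp: z_def null_filiform_def)
    show "fst (\<psi> z) = x \<and> z (n + 1) = a"
      using that fst_\<psi>[of z] by (auto simp: z_def null_filiform_def fun_eq_iff)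
  qed

  obtain W where W: "V.subspace W" "W \<subseteq> V" "\<And>l. sV l (c (n + 1)) \<in> W \<Longrightarrow> sV l (c (n + 1)) = 0"
    "\<And>v. v \<in> V \<Longrightarrow> \<exists>l. v - sV l (c (n + 1)) \<in> W"
    using V.line_complement_in_subspace[OF V(1) c[of "n + 1"]] by blast
  have decomp: "\<exists>z\<in>carr ?M. \<exists>w\<in>W. p = \<psi> z + (0, w)" if "p \<in> carr E" for p
  proof -
    have p: "fst p \<in> carr ?A" "snd p \<in> V" using that by (auto simp: carrE)
    \<comment> \<open>\<open>z0\<close> matches the first component of \<open>p\<close>; a multiple \<open>z1\<close> of \<open>e\<^bsub>n+1\<^esub>\<close> then corrects the
        second component up to an element of \<open>W\<close>.\<close>
    obtain z0 where z0: "z0 \<in> carr ?M" "fst (\<psi> z0) = fst p" using \<psi>_sec[OF p(1), of 0] by blast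
    have "snd p - snd (\<psi> z0) \<in> V"
      using p(2) \<psi>_carr[of z0] V(1) by (auto simp: carrE mem_Times_iff intro: V.subspace_diff)
    then obtain l where l: "snd p - snd (\<psi> z0) - sV l (c (n + 1)) \<in> W" using W(4) by blast
    obtain z1 where z1: "z1 \<in> carr ?M" "fst (\<psi> z1) = 0" "z1 (n + 1) = l"
      using \<psi>_sec[OF A0, of l] by blast
    have "p = \<psi> (z0 + z1) + (0, snd p - snd (\<psi> z0) - sV l (c (n + 1)))"
      using ker[OF z1(2)] z0(2) z1 by (simp add: \<psi>_add prod_eq_iff)
    moreover have "z0 + z1 \<in> carr ?M" using z0 z1 M.carr_subspace by (simp add: M.subspace_add)
    ultimately show ?thesis using l by blast
  qed

  have W0: "W = {0}"
  proof (rule ccontr)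
    assume "W \<noteq> {0}"
    let ?I = "{0 :: nat \<Rightarrow> 'k} \<times> W" and ?E0 = "\<psi> ` carr ?M"
    have 1: "E.subspace ?I"
    proof (rule E.subspaceI)
      show "0 \<in> ?I" using V.subspace_0[OF W(1)] by (simp add: zero_prod_def)
      show "p + q \<in> ?I" if "p \<in> ?I" "q \<in> ?I" for p q
        using that V.subspace_add[OF W(1)] by auto
      show "scal E a p \<in> ?I" if "p \<in> ?I" for a p
        using that V.subspace_scale[OF W(1)] by (auto simp: scalE)
    qed
    have 2: "?I \<noteq> {0}" using \<open>W \<noteq> {0}\<close> V.subspace_0[OF W(1)] by (fastforce simp: zero_prod_def)
    have 3: "?I \<subseteq> annihilator E"
    proof -
      have "prd ?A 0 y = 0" "prd ?A y 0 = 0" "\<theta> 0 y = 0" "\<theta> y 0 = 0" if "y \<in> carr ?A" for y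
        using that bilinear_on_zero_left bilinear_on_zero_right A.prd_bilinear \<theta> A0 by blast+
      then show ?thesis
        using W(2) A0 by (auto simp: annihilator_def carrE prdE zero_prod_def)
    qed
    have 4: "alg_ideal E ?E0"
      unfolding alg_ideal_def
    proof (intro conjI ballI)
      show "E.subspace ?E0"
      proof (rule E.subspaceI)
        have "\<psi> 0 = 0" using \<psi>_add[of 0 0] by simp
        then show "0 \<in> ?E0" using M.carr_subspace M.subspace_0 by force
        show "p + q \<in> ?E0" if "p \<in> ?E0" "q \<in> ?E0" for p q
          using that M.carr_subspace by (auto simp: \<psi>_add[symmetric] M.subspace_add)
        show "scal E a p \<in> ?E0" if "p \<in> ?E0" for a p
          using that M.subspace_scale[OF M.carr_subspace] by (metis (no_types) \<psi>_scale imageE imageI)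
      qed
      show "?E0 \<subseteq> carr E" using \<psi>_carr by auto
      \<comment> \<open>Products do not see the \<open>V\<close>-component of a factor, and modulo \<open>V\<close> every factor comes from \<open>\<psi>\<close>.\<close>
      fix p q assume "p \<in> ?E0" "q \<in> carr E"
      then obtain x y w where xy: "x \<in> carr ?M" "y \<in> carr ?M" "p = \<psi> x" "q = \<psi> y + (0, w)"
        using decomp by blast
      have "prd E r (s + (0, w)) = prd E r s" "prd E (s + (0, w)) r = prd E s r" for r s
        by (cases r; cases s; simp add: prdE)+
      then have "prd E p q = \<psi> (prd ?M x y)" "prd E q p = \<psi> (prd ?M y x)"
        by (simp_all only: xy \<psi>_prd)
      then show "prd E p q \<in> ?E0" "prd E q p \<in> ?E0" using xy M.prd_closed by auto
    qed
    have 5: "carr E = {x + y | x y. x \<in> ?E0 \<and> y \<in> ?I}"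
    proof
      show "carr E \<subseteq> {x + y | x y. x \<in> ?E0 \<and> y \<in> ?I}" using decomp by blast
      show "{x + y | x y. x \<in> ?E0 \<and> y \<in> ?I} \<subseteq> carr E"
      proof -
        have "?I \<subseteq> carr E" using W(2) A0 by (auto simp: carrE)
        then show ?thesis using \<psi>_carr E.carr_subspace by (blast intro: E.subspace_add)
      qed
    qed
    have 6: "?E0 \<inter> ?I = {0}"
    proof
      show "?E0 \<inter> ?I \<subseteq> {0}"
      proof
        fix p assume "p \<in> ?E0 \<inter> ?I"
        then obtain z where "p = \<psi> z" by blast
        moreover have "fst p = 0" "snd p \<in> W"
          using \<open>p \<in> ?E0 \<inter> ?I\<close> by (simp_all add: mem_Times_iff)
        ultimately show "p \<in> {0}" using ker[of z] W(3) by (auto simp: zero_prod_def)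
      qed
      show "{0} \<subseteq> ?E0 \<inter> ?I"
        using 1 4 E.subspace_0 by (simp add: alg_ideal_def)
    qed
    show False using ns 1 2 3 4 5 6 unfolding non_split_def by blast
  qed

  have c_nz: "c (n + 1) \<noteq> 0"
  proof
    assume "c (n + 1) = 0"
    then have "V \<subseteq> {0}" using W(4) W0 by auto
    then show False using V(2) V0 by blast
  qed
  have "bij_betw \<psi> (carr ?M) (carr E)"
  proof (rule bij_betw_imageI)
    show "\<psi> ` carr ?M = carr E"
    proof
      show "\<psi> ` carr ?M \<subseteq> carr E" using \<psi>_carr by blast
      show "carr E \<subseteq> \<psi> ` carr ?M"
      proof
        fix p assume "p \<in> carr E"
        then obtain z where "z \<in> carr ?M" "p = \<psi> z + (0, 0)" using decomp W0 by blast
        then show "p \<in> \<psi> ` carr ?M" by (simp only: zero_prod_def[symmetric] add_0_right imageI)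
      qed
    qed
    show "inj_on \<psi> (carr ?M)"
    proof (rule inj_onI)
      fix x y assume xy: "x \<in> carr ?M" "y \<in> carr ?M" "\<psi> x = \<psi> y"
      have "x - y \<in> carr ?M" using xy M.carr_subspace by (simp add: M.subspace_diff)
      have 0: "\<psi> (x - y) = 0" using \<psi>_add[of "x - y" y] xy(3) by simp
      have "(x - y) k = 0" for k
      proof -
        consider "k \<in> {1..n}" | "k = n + 1" | "k \<notin> {1..n+1}" by force
        then show ?thesis
        proof cases
          case 1
          then show ?thesis using fst_\<psi>[of "x - y" k] 0 by simp
        next
          case 2
          then show ?thesis using ker[of "x - y"] 0 c_nz by (simp add: zero_prod_def)
        next
          case 3
          then show ?thesis using \<open>x - y \<in> carr ?M\<close> by (simp add: null_filiform_def)
        qed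
      qed
      then show "x = y" by (auto simp: fun_eq_iff)
    qed
  qed
  then have "alg_isomorphic ?M E"
    unfolding alg_isomorphic_def using \<psi>_add \<psi>_scale \<psi>_prd by blast
  then show ?thesis
    by (rule alg_isomorphic_sym[OF M.nonassoc_algebra_axioms])
qed

theorem theorem3p2:
  fixes n :: nat
    and sV :: "'k::field \<Rightarrow> 'v::ab_group_add \<Rightarrow> 'v"
    and V :: "'v set"
  assumes "CHAR('k) \<noteq> 2"
    and "n \<ge> 1"
    and "vector_space sV" and "module.subspace sV V" and "V \<noteq> {0}"
  shows "(\<forall>E. central_extension_in left_alternative (null_filiform n) sV V E \<and> non_split E
            \<longrightarrow> alg_isomorphic E (null_filiform (n + 1)))
       \<and> (\<forall>E. central_extension_in alternative (null_filiform n) sV V E \<and> non_split E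
            \<longrightarrow> alg_isomorphic E (null_filiform (n + 1)))"
proof (intro conjI allI impI; elim conjE)
  fix E :: "('k, (nat \<Rightarrow> 'k) \<times> 'v) nalgebra"
  assume "non_split E"
  note iso = left_alternative_non_split_iso[OF assms(1,3-5) _ this]
  show "alg_isomorphic E (null_filiform (n + 1))"
    if "central_extension_in left_alternative (null_filiform n) sV V E"
    using iso[OF that] .
  show "alg_isomorphic E (null_filiform (n + 1))"
    if "central_extension_in alternative (null_filiform n) sV V E"
    using iso that by (auto simp: central_extension_in_def alternative_def)
qed

end
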